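(* Let $\pi_A,\pi_B,\sigma_A,\sigma_B>0$, $\zeta\in(0,1)$, $\gamma>0$, $-1\le\rho<1$, let $b=\frac{\sigma_B\pi_A}{\sigma_A\pi_B}$ and suppose $b>1$ and $b\rho<1$. Let $\psi_A=\zeta\gamma\frac{\sigma_A}{\pi_A}$, $\lambda_1=1+b^2-2b\rho$, $\lambda_2=1-b\rho$, and for $n\in(0,1)$ let $$\psi(n)=\psi_A\left(\lambda_1\tilde n^2-2\lambda_2\tilde n+1\right)^{1/2},\qquad \tilde n=\frac{n\pi_B}{(1-n)\pi_A+n\pi_B}.$$ Then the number $$n_{ct}=\frac{2\lambda_2\pi_A}{2\lambda_2\pi_A+(\lambda_1-2\lambda_2)\pi_B}$$ belongs to $(0,1)$, $\psi(n_{ct})=\psi_A$, and for $n\in(0,1)$: $\psi(n)<\psi_A$ if $n<n_{ct}$, and $\psi(n)>\psi_A$ if $n>n_{ct}$.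
   Context: Two insurance business lines $A$ and $B$ have per-policy random present values of payouts with positive finite means $\pi_A,\pi_B$, positive finite standard deviations $\sigma_A,\sigma_B$ and correlation coefficient $\rho\in[-1,1)$. With the mean-standard deviation risk measure $\varphi[V]=E[V]+\gamma\,\mathrm{sd}(V)$ and risk reduction factor $\zeta$, $\psi_A$ is the stand-alone proportional loading of line $A$, and $\psi(n)$ is the common proportional loading required when both lines are priced jointly and $n=\frac{N_B}{N_A+N_B}$ is the proportion of policies sold in line $B$, where the numbers of policies satisfy $N_A,N_B>0$ (so $n\in(0,1)$). The number $n_{ct}$ is called the critical threshold. *)

theory Defs
  imports Complex_Main
begin

end

theory Submission
  imports Defs
begin

text \<open>
  The radicand minus 1 is \<open>n_tilde * (lambda\<^sub>1 * n_tilde - 2 * lambda\<^sub>2)\<close>. Clearing the denominator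
  of the second factor leaves an affine function of \<open>n\<close> with root \<open>n\<^sub>c\<^sub>t\<close> and positive slope,
  because \<open>lambda\<^sub>2 > 0\<close> and \<open>lambda\<^sub>1 - 2 * lambda\<^sub>2 = b\<^sup>2 - 1 > 0\<close>.
\<close>

theorem lemma3p2:
  fixes \<pi>\<^sub>A \<pi>\<^sub>B \<sigma>\<^sub>A \<sigma>\<^sub>B \<zeta> \<gamma> \<rho> b \<psi>\<^sub>A lambda\<^sub>1 lambda\<^sub>2 n\<^sub>c\<^sub>t :: real
    and \<psi> n_tilde :: "real \<Rightarrow> real"
  assumes "\<pi>\<^sub>A > 0" and "\<pi>\<^sub>B > 0" and "\<sigma>\<^sub>A > 0" and "\<sigma>\<^sub>B > 0"
    and "0 < \<zeta>" and "\<zeta> < 1" and "\<gamma> > 0"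
    and "-1 \<le> \<rho>" and "\<rho> < 1"
    and b: "b = (\<sigma>\<^sub>B * \<pi>\<^sub>A) / (\<sigma>\<^sub>A * \<pi>\<^sub>B)"
    and "b > 1" and "b * \<rho> < 1"
    and psi_A: "\<psi>\<^sub>A = \<zeta> * \<gamma> * (\<sigma>\<^sub>A / \<pi>\<^sub>A)"
    and lambda_1: "lambda\<^sub>1 = 1 + b\<^sup>2 - 2 * b * \<rho>"
    and lambda_2: "lambda\<^sub>2 = 1 - b * \<rho>"
    and n_tilde: "\<And>n. n \<in> {0<..<1} \<Longrightarrow> n_tilde n = (n * \<pi>\<^sub>B) / ((1 - n) * \<pi>\<^sub>A + n * \<pi>\<^sub>B)"
    and psi: "\<And>n. n \<in> {0<..<1} \<Longrightarrow>
      \<psi> n = \<psi>\<^sub>A * sqrt (lambda\<^sub>1 * (n_tilde n)\<^sup>2 - 2 * lambda\<^sub>2 * n_tilde n + 1)"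
    and n_ct: "n\<^sub>c\<^sub>t = (2 * lambda\<^sub>2 * \<pi>\<^sub>A) / (2 * lambda\<^sub>2 * \<pi>\<^sub>A + (lambda\<^sub>1 - 2 * lambda\<^sub>2) * \<pi>\<^sub>B)"
  shows "n\<^sub>c\<^sub>t \<in> {0<..<1} \<and> \<psi> n\<^sub>c\<^sub>t = \<psi>\<^sub>A \<and>
    (\<forall>n \<in> {0<..<1}. (n < n\<^sub>c\<^sub>t \<longrightarrow> \<psi> n < \<psi>\<^sub>A) \<and> (n > n\<^sub>c\<^sub>t \<longrightarrow> \<psi> n > \<psi>\<^sub>A))"
proof -
  \<comment> \<open>\<open>K\<close> is the denominator of \<open>n\<^sub>c\<^sub>t\<close> and also
    the slope of the affine function of \<open>n\<close>.\<close>
  define K where "K = 2 * lambda\<^sub>2 * \<pi>\<^sub>A + (lambda\<^sub>1 - 2 * lambda\<^sub>2) * \<pi>\<^sub>B"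
  have "1 < b\<^sup>2"
    using \<open>b > 1\<close> by (simp add: one_less_power)
  then have "0 < lambda\<^sub>1 - 2 * lambda\<^sub>2"
    by (simp add: lambda_1 lambda_2)
  then have B: "0 < (lambda\<^sub>1 - 2 * lambda\<^sub>2) * \<pi>\<^sub>B"
    using \<open>\<pi>\<^sub>B > 0\<close> by simp
  have A: "0 < 2 * lambda\<^sub>2 * \<pi>\<^sub>A"
    using \<open>b * \<rho> < 1\<close> \<open>\<pi>\<^sub>A > 0\<close> by (simp add: lambda_2)
  have K: "0 < K"
    using add_pos_pos[OF A B] by (simp add: K_def)
  have nct_K: "n\<^sub>c\<^sub>t * K = 2 * lambda\<^sub>2 * \<pi>\<^sub>A"
    using K by (simp add: n_ct K_def)
  \<comment> \<open>The threshold has the form x / (x + y), with x and y positive by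
    \<open>A\<close> and \<open>B\<close>.\<close>
  have nct: "n\<^sub>c\<^sub>t \<in> {0<..<1}"
    using A B K by (simp add: n_ct flip: K_def) (simp add: K_def)
  have psi_A_pos: "0 < \<psi>\<^sub>A"
    using assms by (simp add: psi_A)
  \<comment> \<open>The factor \<open>c\<close> may vary with \<open>n\<close>. Only its sign
    matters, since all three claims depend just on the sign of
    \<open>n - n\<^sub>c\<^sub>t\<close>.\<close>
  have key: "\<exists>c>0. \<psi> n = \<psi>\<^sub>A * sqrt (1 + c * (n - n\<^sub>c\<^sub>t))" if n: "n \<in> {0<..<1}" for n
  proof -
    define D where "D = (1 - n) * \<pi>\<^sub>A + n * \<pi>\<^sub>B"
    have D: "0 < D"
      using n \<open>\<pi>\<^sub>A > 0\<close> \<open>\<pi>\<^sub>B > 0\<close> by (simp add: D_def add_pos_pos)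
    have t: "n_tilde n = n * \<pi>\<^sub>B / D"
      using n_tilde[OF n] by (simp add: D_def)
    \<comment> \<open>Through \<open>nct_K\<close> the quotient \<open>n\<^sub>c\<^sub>t\<close>
      disappears, and a polynomial identity remains.\<close>
    have "lambda\<^sub>1 * (n * \<pi>\<^sub>B) - 2 * lambda\<^sub>2 * D = n * K - n\<^sub>c\<^sub>t * K"
      unfolding nct_K by (simp add: D_def K_def algebra_simps)
    then have "lambda\<^sub>1 * n_tilde n - 2 * lambda\<^sub>2 = K / D * (n - n\<^sub>c\<^sub>t)"
      using D by (simp add: t field_simps)
    moreover have "lambda\<^sub>1 * (n_tilde n)\<^sup>2 - 2 * lambda\<^sub>2 * n_tilde n + 1
        = 1 + n_tilde n * (lambda\<^sub>1 * n_tilde n - 2 * lambda\<^sub>2)"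
      by (simp add: power2_eq_square algebra_simps)
    ultimately have "lambda\<^sub>1 * (n_tilde n)\<^sup>2 - 2 * lambda\<^sub>2 * n_tilde n + 1
        = 1 + n_tilde n * (K / D) * (n - n\<^sub>c\<^sub>t)"
      by simp
    \<comment> \<open>This product is the witness for \<open>c\<close>. The factor
      \<open>n_tilde n\<close> vanishes only at \<open>n = 0\<close>, which lies outside the open
      interval.\<close>
    moreover have "0 < n_tilde n * (K / D)"
      using n D K \<open>\<pi>\<^sub>B > 0\<close> by (simp add: t)
    ultimately show ?thesis
      using psi[OF n] by auto
  qed
  have "\<psi> n\<^sub>c\<^sub>t = \<psi>\<^sub>A"
    using key[OF nct] by auto
  moreover have "(n < n\<^sub>c\<^sub>t \<longrightarrow> \<psi> n < \<psi>\<^sub>A) \<and> (n > n\<^sub>c\<^sub>t \<longrightarrow> \<psi> n > \<psi>\<^sub>A)" if n: "n \<in> {0<..<1}" for n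
  proof -
    obtain c where "c > 0" and c: "\<psi> n = \<psi>\<^sub>A * sqrt (1 + c * (n - n\<^sub>c\<^sub>t))"
      using key[OF n] by blast
    \<comment> \<open>Dividing by \<open>\<psi>\<^sub>A > 0\<close> leaves a comparison of the root
      with 1. In HOL \<open>sqrt\<close> is odd and strictly increasing on all reals, so the
      comparison passes to the radicand without a check of its sign.\<close>
    then show ?thesis
      using psi_A_pos by (simp add: mult_less_0_iff)
  qed
  ultimately show ?thesis
    using nct by blast
qed

end
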